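(* Let $\mu$ be a fixed capacity-feasible matching and let $$\Phi_r(\mu)=\min_{z\ge 0}\max_i\frac{D_i^{(r)}(\mu,z)}{B_i}.$$ Then the optimal core factor of the fixed capacity matching $\mu$ is $$\alpha_r(\mu)=\frac{1}{\Phi_r(\mu)}.$$
   Context: Market: firms $F=\{1,\dots,m\}$, workers $W=\{1,\dots,n\}$, values $a_{ij}\ge 0$, additive: $V_i(T)=\sum_{j\in T}a_{ij}$. Firm $i$ has capacity $r_i\in\mathbb Z_+$. A capacity-feasible matching $\mu$ assigns pairwise disjoint sets $\mu(i)\subseteq W$ to firms with $|\mu(i)|\le r_i$; unmatched workers are treated as assigned to a zero-value dummy node. $B_i=V_i(\mu(i))$. For $I\subseteq F$, $T\subseteq W$, the capacity-constrained deviation value $v_r(I,T)$ is the maximum total value $\sum a_{ij}$ obtainable by assigning workers in $T$ to firms in $I$ (each worker to at most one firm), with each firm $i\in I$ receiving at most $r_i$ workers. Payments: firm profits $x_i\ge 0$ ($i\in F$) and worker wages $y_j\ge 0$ ($j\in W$) satisfy local financing if $x_i+\sum_{j\in\mu(i)}y_j=B_i$ for every firm $i\in F$. $(\mu,x,y)$ is in the $\alpha$-core if $\sum_{i\in I}x_i+\sum_{j\in T}y_j\ge\alpha\,v_r(I,T)$ for all $I\subseteq F$, $T\subseteq W$. The optimal core factor $\alpha_r(\mu)$ is the largest $\alpha$ that can be supported by nonnegative payments satisfying local financing, i.e. for which such payments put $(\mu,x,y)$ in the $\alpha$-core. For a nonnegative vector $u$, $\mathrm{Top}_r(u)$ is the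 sum of its largest at most $r$ coordinates. With $[u]_+=\max\{u,0\}$, $$D_i^{(r)}(\mu,z)=\sum_{j\in\mu(i)}z_j+\mathrm{Top}_{r_i}\bigl(([a_{ij}-z_j]_+)_{j\in W}\bigr).$$ In $\Phi_r(\mu)$, the minimum is over all vectors $z=(z_j)_{j\in W}$ with $z_j\ge 0$ for every worker $j$, and the maximum is over firms $i\in F$. If $B_i=0$, the ratio $D_i^{(r)}/B_i$ is read as $+\infty$ if $D_i^{(r)}>0$ and as $0$ if $D_i^{(r)}=0$. Conventions: $1/(+\infty)=0$, $1/0=+\infty$. *)

theory Defs
  imports
    Complex_Main
    "HOL-Library.Multiset"
    "HOL-Library.Disjoint_Sets"
    "HOL-Library.Extended_Nonnegative_Real"
begin

definition coalition_value :: "('f \<Rightarrow> 'w \<Rightarrow> real) \<Rightarrow> 'f \<Rightarrow> 'w set \<Rightarrow> real" where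
  "coalition_value a i T = (\<Sum>j\<in>T. a i j)"

definition capacity_matching :: "'f set \<Rightarrow> 'w set \<Rightarrow> ('f \<Rightarrow> nat) \<Rightarrow> ('f \<Rightarrow> 'w set) \<Rightarrow> bool" where
  "capacity_matching F W r \<mu> \<longleftrightarrow>
     (\<forall>i\<in>F. \<mu> i \<subseteq> W \<and> card (\<mu> i) \<le> r i) \<and> disjoint_family_on \<mu> F"

(* An assignment of workers in T to firms in I is the same thing as a matching of the
   submarket (I, T).  For finite I and T only finitely many values occur, and the empty
   assignment is always available, so Max is a genuine maximum. *)
definition deviation_value ::
  "('f \<Rightarrow> 'w \<Rightarrow> real) \<Rightarrow> ('f \<Rightarrow> nat) \<Rightarrow> 'f set \<Rightarrow> 'w set \<Rightarrow> real" where
  "deviation_value a r I T =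
     Max ((\<lambda>\<sigma>. \<Sum>i\<in>I. coalition_value a i (\<sigma> i)) ` {\<sigma>. capacity_matching I T r \<sigma>})"

(* Only firms appear here: the wages of unmatched workers are nonnegative but otherwise
   unconstrained, just as the coordinates z j of unmatched workers are free in core_ratio. *)
definition local_financing ::
  "'f set \<Rightarrow> ('f \<Rightarrow> 'w \<Rightarrow> real) \<Rightarrow> ('f \<Rightarrow> 'w set) \<Rightarrow> ('f \<Rightarrow> real) \<Rightarrow> ('w \<Rightarrow> real) \<Rightarrow> bool" where
  "local_financing F a \<mu> x y \<longleftrightarrow>
     (\<forall>i\<in>F. x i + (\<Sum>j\<in>\<mu> i. y j) = coalition_value a i (\<mu> i))"

definition in_core ::
  "'f set \<Rightarrow> 'w set \<Rightarrow> ('f \<Rightarrow> 'w \<Rightarrow> real) \<Rightarrow> ('f \<Rightarrow> nat) \<Rightarrow> real \<Rightarrow> ('f \<Rightarrow> real) \<Rightarrow> ('w \<Rightarrow> real) \<Rightarrow> bool" where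
  "in_core F W a r \<alpha> x y \<longleftrightarrow>
     (\<forall>I T. I \<subseteq> F \<longrightarrow> T \<subseteq> W \<longrightarrow>
        (\<Sum>i\<in>I. x i) + (\<Sum>j\<in>T. y j) \<ge> \<alpha> * deviation_value a r I T)"

definition supportable ::
  "'f set \<Rightarrow> 'w set \<Rightarrow> ('f \<Rightarrow> 'w \<Rightarrow> real) \<Rightarrow> ('f \<Rightarrow> nat) \<Rightarrow> ('f \<Rightarrow> 'w set) \<Rightarrow> real \<Rightarrow> bool" where
  "supportable F W a r \<mu> \<alpha> \<longleftrightarrow>
     (\<exists>x y. (\<forall>i\<in>F. x i \<ge> 0) \<and> (\<forall>j\<in>W. y j \<ge> 0) \<and>
        local_financing F a \<mu> x y \<and> in_core F W a r \<alpha> x y)"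

(* The value is infinite when arbitrarily large factors are supportable.  Restricting to
   nonnegative factors loses nothing: 0 is always supportable by y = 0 and
   x i = coalition_value a i (\<mu> i). *)
definition core_factor ::
  "'f set \<Rightarrow> 'w set \<Rightarrow> ('f \<Rightarrow> 'w \<Rightarrow> real) \<Rightarrow> ('f \<Rightarrow> nat) \<Rightarrow> ('f \<Rightarrow> 'w set) \<Rightarrow> ennreal" where
  "core_factor F W a r \<mu> = (SUP \<alpha>\<in>{\<alpha>. \<alpha> \<ge> 0 \<and> supportable F W a r \<mu> \<alpha>}. ennreal \<alpha>)"

(* Coordinates are listed with multiplicity in decreasing order, and the first k of them
   (all of them if there are fewer than k) are added up. *)
definition top_sum :: "nat \<Rightarrow> 'w set \<Rightarrow> ('w \<Rightarrow> real) \<Rightarrow> real" where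
  "top_sum k W u =
     sum_list (take k (rev (sorted_list_of_multiset (image_mset u (mset_set W)))))"

definition firm_burden ::
  "'w set \<Rightarrow> ('f \<Rightarrow> 'w \<Rightarrow> real) \<Rightarrow> ('f \<Rightarrow> nat) \<Rightarrow> ('f \<Rightarrow> 'w set) \<Rightarrow> ('w \<Rightarrow> real) \<Rightarrow> 'f \<Rightarrow> real" where
  "firm_burden W a r \<mu> z i =
     (\<Sum>j\<in>\<mu> i. z j) + top_sum (r i) W (\<lambda>j. max (a i j - z j) 0)"

definition burden_ratio :: "real \<Rightarrow> real \<Rightarrow> ennreal" where
  "burden_ratio d b = (if b = 0 then (if d > 0 then \<infinity> else 0) else ennreal (d / b))"

(* In ennreal the supremum over a finite nonempty F is the maximum, and it is 0 for F = {}. *)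
definition max_ratio ::
  "'f set \<Rightarrow> 'w set \<Rightarrow> ('f \<Rightarrow> 'w \<Rightarrow> real) \<Rightarrow> ('f \<Rightarrow> nat) \<Rightarrow> ('f \<Rightarrow> 'w set) \<Rightarrow> ('w \<Rightarrow> real) \<Rightarrow> ennreal" where
  "max_ratio F W a r \<mu> z =
     (SUP i\<in>F. burden_ratio (firm_burden W a r \<mu> z i) (coalition_value a i (\<mu> i)))"

definition core_ratio ::
  "'f set \<Rightarrow> 'w set \<Rightarrow> ('f \<Rightarrow> 'w \<Rightarrow> real) \<Rightarrow> ('f \<Rightarrow> nat) \<Rightarrow> ('f \<Rightarrow> 'w set) \<Rightarrow> ennreal" where
  "core_ratio F W a r \<mu> = (INF z\<in>{z. \<forall>j\<in>W. z j \<ge> 0}. max_ratio F W a r \<mu> z)"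

end

theory Submission imports Defs begin

(* The core inequalities for single firms imply all the others, by summation over an optimal
   assignment.  Local financing forces x i = B i - y(mu i), so after the scaling y = alpha * z a
   factor alpha > 0 is supportable iff z(mu i) + (sum of a i j - z j over S) <= B i / alpha for every
   firm i and every set S of at most r i workers, which says D i <= B i / alpha.  These finitely many
   linear inequalities in z stay valid when z is truncated at a common upper bound of the values, so
   compactness provides a minimizer. *)

section \<open>Sums of the k largest coordinates\<close>

text \<open>Exchange argument by induction on the list: the head is worth at least as much as the
  element removed from \<open>S\<close>, and the remaining elements compete with the first k - 1
  entries of the tail. Nonnegativity covers the case where \<open>S\<close> runs out before the k
  entries do.\<close>

lemma sum_le_sum_list_take:
  assumes "sorted_wrt (\<lambda>x y. u y \<le> u x) ys" and "\<And>x. x \<in> set ys \<Longrightarrow> (0::real) \<le> u x"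
    and "S \<subseteq> set ys" and "card S \<le> k"
  shows "sum u S \<le> sum_list (map u (take k ys))"
  using assms
proof (induction ys arbitrary: S k)
  case Nil
  then show ?case by simp
next
  case (Cons y ys)
  have fin: "finite S" using Cons.prems(3) finite_subset by blast
  have nonneg: "0 \<le> sum_list (map u (take k (y # ys)))"
    using Cons.prems(2) by (intro sum_list_nonneg) (auto dest: in_set_takeD)
  show ?case
  proof (cases "S = {}")
    case True
    then show ?thesis using nonneg by simp
  next
    case False
    \<comment> \<open>Choosing the head itself whenever it belongs to \<open>S\<close> guarantees
      that \<open>S - {s}\<close> lies in the tail.\<close>
    then obtain s where s: "s \<in> S" "y \<in> S \<Longrightarrow> s = y" by blast
    have "card S \<noteq> 0" using False fin by simp
    then obtain k' where k: "k = Suc k'" using Cons.prems(4) by (cases k) auto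
    have "S - {s} \<subseteq> set ys" using Cons.prems(3) s by auto
    moreover have "card (S - {s}) \<le> k'" using Cons.prems(4) k s fin by simp
    ultimately have "sum u (S - {s}) \<le> sum_list (map u (take k' ys))"
      using Cons.IH Cons.prems(1,2) by simp
    moreover have "u s \<le> u y" using s Cons.prems(1,3) by auto
    moreover have "sum u S = u s + sum u (S - {s})" using fin s by (simp add: sum.remove)
    ultimately show ?thesis using k by simp
  qed
qed

text \<open>The first k workers in decreasing order of \<open>u\<close> form an admissible set whose
  sum is \<open>top_sum\<close>, and this sum dominates that of every other admissible set. Sorting
  workers instead of their values keeps equal coordinates apart.\<close>

lemma top_sum_le_iff:
  assumes "finite W" and nonneg: "\<And>j. j \<in> W \<Longrightarrow> 0 \<le> u j"
  shows "top_sum k W u \<le> d \<longleftrightarrow> (\<forall>S. S \<subseteq> W \<longrightarrow> card S \<le> k \<longrightarrow> sum u S \<le> d)"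
proof -
  obtain ws where ws: "set ws = W" "distinct ws"
    using finite_distinct_list[OF \<open>finite W\<close>] by blast
  define ys where "ys = rev (sort_key u ws)"
  have set_ys: "set ys = W" and dist: "distinct ys" using ws by (auto simp: ys_def)
  have "image_mset u (mset_set W) = mset (map u (sort_key u ws))"
    using ws by (metis mset_map mset_set_set mset_sort)
  then have "sorted_list_of_multiset (image_mset u (mset_set W)) = map u (sort_key u ws)"
    by (metis sorted_list_of_multiset_mset sorted_sort_id sorted_sort_key)
  then have top: "top_sum k W u = sum_list (map u (take k ys))"
    by (simp add: top_sum_def ys_def rev_map take_map)
  have sorted: "sorted_wrt (\<lambda>x y. u y \<le> u x) ys"
    using sorted_sort_key[of u ws] by (simp add: ys_def sorted_wrt_rev sorted_map)
  have le: "sum u S \<le> top_sum k W u" if "S \<subseteq> W" "card S \<le> k" for S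
    unfolding top using sorted nonneg set_ys that by (intro sum_le_sum_list_take) auto
  have "sum u (set (take k ys)) = top_sum k W u"
    using dist by (simp add: top sum_list_distinct_conv_sum_set)
  moreover have "card (set (take k ys)) \<le> k"
    by (metis card_length length_take min.cobounded2 order_trans)
  moreover have "set (take k ys) \<subseteq> W" using set_ys set_take_subset by metis
  ultimately show ?thesis using le by (metis order_trans)
qed

text \<open>Discarding the workers with negative \<open>u\<close> keeps a set admissible and turns
  its sum into the sum of positive parts. Quantifying over all small sets therefore absorbs the
  truncation at 0 and leaves conditions linear in \<open>u\<close>.\<close>

lemma top_sum_pos_part_le_iff:
  fixes u :: "'w \<Rightarrow> real"
  assumes "finite W"
  shows "top_sum k W (\<lambda>j. max (u j) 0) \<le> d \<longleftrightarrow>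
    (\<forall>S. S \<subseteq> W \<longrightarrow> card S \<le> k \<longrightarrow> sum u S \<le> d)"
proof -
  have "sum (\<lambda>j. max (u j) 0) S \<le> d"
    if all: "\<forall>S. S \<subseteq> W \<longrightarrow> card S \<le> k \<longrightarrow> sum u S \<le> d" and S: "S \<subseteq> W" "card S \<le> k" for S
  proof -
    let ?S = "{j \<in> S. 0 \<le> u j}"
    have fin: "finite S" using S(1) assms finite_subset by blast
    then have "card ?S \<le> card S" by (intro card_mono) auto
    then have "?S \<subseteq> W" "card ?S \<le> k" using S by auto
    then have "sum u ?S \<le> d" using all by blast
    moreover have "sum u ?S = sum (\<lambda>j. max (u j) 0) S"
      using fin by (simp add: sum.inter_filter max_def) (intro sum.cong, auto)
    ultimately show ?thesis by simp
  qed
  moreover have "sum u S \<le> d" if "sum (\<lambda>j. max (u j) 0) S \<le> d" for S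
    using sum_mono[of S u "\<lambda>j. max (u j) 0"] that by auto
  ultimately show ?thesis
    unfolding top_sum_le_iff[OF assms, of "\<lambda>j. max (u j) 0", simplified] by blast
qed

section \<open>Compactness in finitely many coordinates\<close>

text \<open>Coordinates are treated one at a time: a monotone subsequence of the new coordinate
  converges by boundedness, and the limits found earlier survive the refinement.\<close>

lemma finite_family_convergent_subseq:
  fixes Z :: "nat \<Rightarrow> 'w \<Rightarrow> real"
  assumes "finite W" and "\<And>j. j \<in> W \<Longrightarrow> Bseq (\<lambda>n. Z n j)"
  shows "\<exists>s l. strict_mono s \<and> (\<forall>j\<in>W. (\<lambda>n. Z (s n) j) \<longlonglongrightarrow> l j)"
  using assms
proof (induction W rule: finite_induct)
  case empty
  then show ?case using strict_mono_id by blast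
next
  case (insert w W)
  then obtain s l where s: "strict_mono s" and l: "\<And>j. j \<in> W \<Longrightarrow> (\<lambda>n. Z (s n) j) \<longlonglongrightarrow> l j"
    by auto
  obtain t :: "nat \<Rightarrow> nat" where t: "strict_mono t" and mono: "monoseq (\<lambda>n. Z (s (t n)) w)"
    using seq_monosub[of "\<lambda>n. Z (s n) w"] by auto
  have "Bseq (\<lambda>n. Z (s (t n)) w)"
    using insert.prems Bseq_subseq[of "\<lambda>n. Z n w" "s \<circ> t"] by simp
  then obtain lw where lw: "(\<lambda>n. Z (s (t n)) w) \<longlonglongrightarrow> lw"
    using mono Bseq_monoseq_convergent convergent_def by blast
  have "(\<lambda>n. Z ((s \<circ> t) n) j) \<longlonglongrightarrow> (l(w := lw)) j" if "j \<in> insert w W" for j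
    using that insert.hyps lw LIMSEQ_subseq_LIMSEQ[OF l t] by (auto simp: o_def)
  then show ?case using strict_mono_o[OF s t] by blast
qed

section \<open>Ratio bounds as linear inequalities\<close>

text \<open>The convention for \<open>b = 0\<close> is what makes the form without division valid
  there: both sides then say \<open>d \<le> 0\<close>.\<close>

lemma burden_ratio_le_iff:
  assumes "0 \<le> b" and "0 \<le> t"
  shows "burden_ratio d b \<le> ennreal t \<longleftrightarrow> d \<le> t * b"
  using assms by (auto simp: burden_ratio_def top_unique pos_divide_le_eq ennreal_le_iff)

locale capacity_market =
  fixes F :: "'f set" and W :: "'w set"
    and a :: "'f \<Rightarrow> 'w \<Rightarrow> real" and r :: "'f \<Rightarrow> nat" and \<mu> :: "'f \<Rightarrow> 'w set"
  assumes finite_F: "finite F" and finite_W: "finite W"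
    and value_nonneg: "\<And>i j. i \<in> F \<Longrightarrow> j \<in> W \<Longrightarrow> a i j \<ge> 0"
    and matching: "capacity_matching F W r \<mu>"
begin

abbreviation B :: "'f \<Rightarrow> real" where "B i \<equiv> coalition_value a i (\<mu> i)"

text \<open>The bound t on the maximal ratio with maximum, \<open>top_sum\<close> and quotient
  unfolded into linear inequalities. In this form it can be scaled, truncated and passed to
  limits.\<close>

definition burden_at_most :: "real \<Rightarrow> ('w \<Rightarrow> real) \<Rightarrow> bool" where
  "burden_at_most t z \<longleftrightarrow> (\<forall>i\<in>F. \<forall>S. S \<subseteq> W \<longrightarrow> card S \<le> r i \<longrightarrow>
     (\<Sum>j\<in>\<mu> i. z j) + (\<Sum>j\<in>S. a i j - z j) \<le> t * B i)"

lemma matched_subset: "i \<in> F \<Longrightarrow> \<mu> i \<subseteq> W"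
  using matching by (auto simp: capacity_matching_def)

lemma B_nonneg: "i \<in> F \<Longrightarrow> 0 \<le> B i"
  unfolding coalition_value_def using matched_subset value_nonneg by (intro sum_nonneg) blast

lemma firm_burden_le_iff:
  "firm_burden W a r \<mu> z i \<le> d \<longleftrightarrow>
     (\<forall>S. S \<subseteq> W \<longrightarrow> card S \<le> r i \<longrightarrow> (\<Sum>j\<in>\<mu> i. z j) + (\<Sum>j\<in>S. a i j - z j) \<le> d)"
proof -
  have "firm_burden W a r \<mu> z i \<le> d \<longleftrightarrow>
      top_sum (r i) W (\<lambda>j. max (a i j - z j) 0) \<le> d - (\<Sum>j\<in>\<mu> i. z j)"
    by (auto simp: firm_burden_def)
  then show ?thesis
    unfolding top_sum_pos_part_le_iff[OF finite_W] by (simp add: le_diff_eq add.commute)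
qed

lemma max_ratio_le_iff:
  assumes "0 \<le> t"
  shows "max_ratio F W a r \<mu> z \<le> ennreal t \<longleftrightarrow> burden_at_most t z"
  using assms B_nonneg
  by (simp add: max_ratio_def SUP_le_iff burden_ratio_le_iff firm_burden_le_iff burden_at_most_def)

section \<open>Reduction of the core to single firms\<close>

text \<open>A matching of the submarket is unconstrained outside \<open>I\<close>, so there may be
  infinitely many. Resetting each to the empty set there preserves its value and leaves finitely
  many functions.\<close>

lemma deviation_values_finite:
  assumes "I \<subseteq> F" and "T \<subseteq> W"
  shows "finite ((\<lambda>\<sigma>. \<Sum>i\<in>I. coalition_value a i (\<sigma> i)) ` {\<sigma>. capacity_matching I T r \<sigma>})"
proof -
  have fin: "finite I" "finite T"
    using assms finite_F finite_W finite_subset by blast+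
  have "(\<lambda>\<sigma>. \<Sum>i\<in>I. coalition_value a i (\<sigma> i)) ` {\<sigma>. capacity_matching I T r \<sigma>}
      \<subseteq> (\<lambda>\<sigma>. \<Sum>i\<in>I. coalition_value a i (\<sigma> i)) `
          {\<sigma>. \<forall>i. (i \<in> I \<longrightarrow> \<sigma> i \<in> Pow T) \<and> (i \<notin> I \<longrightarrow> \<sigma> i = {})}"
  proof (rule image_subsetI)
    fix \<sigma> assume "\<sigma> \<in> {\<sigma>. capacity_matching I T r \<sigma>}"
    then show "(\<Sum>i\<in>I. coalition_value a i (\<sigma> i)) \<in> (\<lambda>\<sigma>. \<Sum>i\<in>I. coalition_value a i (\<sigma> i)) `
          {\<sigma>. \<forall>i. (i \<in> I \<longrightarrow> \<sigma> i \<in> Pow T) \<and> (i \<notin> I \<longrightarrow> \<sigma> i = {})}"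
      by (intro image_eqI[where x = "\<lambda>i. if i \<in> I then \<sigma> i else {}"])
        (auto simp: capacity_matching_def)
  qed
  moreover have "finite {\<sigma>. \<forall>i. (i \<in> I \<longrightarrow> \<sigma> i \<in> Pow T) \<and> (i \<notin> I \<longrightarrow> \<sigma> i = {})}"
    using fin by (intro finite_set_of_finite_funs) auto
  ultimately show ?thesis using finite_subset by blast
qed

lemma in_core_iff_single_firm:
  assumes "0 \<le> \<alpha>" and y: "\<And>j. j \<in> W \<Longrightarrow> 0 \<le> y j"
  shows "in_core F W a r \<alpha> x y \<longleftrightarrow>
    (\<forall>i\<in>F. \<forall>S. S \<subseteq> W \<longrightarrow> card S \<le> r i \<longrightarrow> \<alpha> * coalition_value a i S \<le> x i + sum y S)"
    (is "?core \<longleftrightarrow> ?single")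
proof
  assume core: ?core
  show ?single
  proof (intro ballI allI impI)
    fix i S assume iS: "i \<in> F" "S \<subseteq> W" "card S \<le> r i"
    have "coalition_value a i S \<le> deviation_value a r {i} S"
      unfolding deviation_value_def
    proof (rule Max_ge)
      show "finite ((\<lambda>\<sigma>. \<Sum>i\<in>{i}. coalition_value a i (\<sigma> i)) ` {\<sigma>. capacity_matching {i} S r \<sigma>})"
        using iS by (intro deviation_values_finite) auto
      \<comment> \<open>The constant assignment is a matching here, since disjointness over a single
        firm is vacuous.\<close>
      show "coalition_value a i S \<in>
          (\<lambda>\<sigma>. \<Sum>i\<in>{i}. coalition_value a i (\<sigma> i)) ` {\<sigma>. capacity_matching {i} S r \<sigma>}"
        using iS by (intro image_eqI[where x = "\<lambda>_. S"])
          (auto simp: capacity_matching_def disjoint_family_on_def)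
    qed
    then have "\<alpha> * coalition_value a i S \<le> \<alpha> * deviation_value a r {i} S"
      using \<open>0 \<le> \<alpha>\<close> by (rule mult_left_mono)
    also have "\<dots> \<le> x i + sum y S"
      using core iS by (auto simp: in_core_def dest!: spec[of _ "{i}"])
    finally show "\<alpha> * coalition_value a i S \<le> x i + sum y S" .
  qed
next
  assume single: ?single
  show ?core
    unfolding in_core_def
  proof (intro allI impI)
    fix I T assume IT: "I \<subseteq> F" "T \<subseteq> W"
    let ?V = "(\<lambda>\<sigma>. \<Sum>i\<in>I. coalition_value a i (\<sigma> i)) ` {\<sigma>. capacity_matching I T r \<sigma>}"
    have "capacity_matching I T r (\<lambda>_. {})"
      by (simp add: capacity_matching_def disjoint_family_on_def)
    then have "Max ?V \<in> ?V"
      using deviation_values_finite[OF IT] by (intro Max_in) auto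
    then obtain \<sigma> where \<sigma>: "capacity_matching I T r \<sigma>"
      and dev: "deviation_value a r I T = (\<Sum>i\<in>I. coalition_value a i (\<sigma> i))"
      by (auto simp: deviation_value_def)
    have fin: "finite I" "finite T"
      using IT finite_F finite_W finite_subset by blast+
    have sub: "\<sigma> i \<subseteq> T" if "i \<in> I" for i
      using \<sigma> that by (auto simp: capacity_matching_def)
    have "\<alpha> * deviation_value a r I T = (\<Sum>i\<in>I. \<alpha> * coalition_value a i (\<sigma> i))"
      by (simp add: dev sum_distrib_left)
    also have "\<dots> \<le> (\<Sum>i\<in>I. x i + sum y (\<sigma> i))"
    proof (rule sum_mono)
      fix i assume i: "i \<in> I"
      then have "card (\<sigma> i) \<le> r i" using \<sigma> by (auto simp: capacity_matching_def)
      then show "\<alpha> * coalition_value a i (\<sigma> i) \<le> x i + sum y (\<sigma> i)"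
        using single i sub IT by blast
    qed
    also have "\<dots> = sum x I + sum y (\<Union>i\<in>I. \<sigma> i)"
    proof -
      have "sum y (\<Union>i\<in>I. \<sigma> i) = (\<Sum>i\<in>I. sum y (\<sigma> i))"
        using \<sigma> fin finite_subset[OF sub]
        by (intro sum.UNION_disjoint) (auto simp: capacity_matching_def disjoint_family_on_def)
      then show ?thesis by (simp add: sum.distrib)
    qed
    \<comment> \<open>Workers of \<open>T\<close> left unassigned by \<sigma> only add nonnegative
      wages.\<close>
    also have "\<dots> \<le> sum x I + sum y T"
      using fin sub y IT by (intro add_left_mono sum_mono2) blast+
    finally show "\<alpha> * deviation_value a r I T \<le> sum x I + sum y T" .
  qed
qed

section \<open>Supportable factors and scaled wages\<close>

lemma supportable_zero: "supportable F W a r \<mu> 0"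
proof -
  have "in_core F W a r 0 B (\<lambda>_. 0)"
    using B_nonneg by (simp add: in_core_iff_single_firm)
  then show ?thesis
    unfolding supportable_def local_financing_def
    using B_nonneg by (intro exI[of _ B] exI[of _ "\<lambda>_. 0"]) auto
qed

text \<open>With x eliminated by local financing and y = \<alpha> * z, the single-firm core
  inequality for i and S, divided by \<alpha>, is exactly the inequality of
  \<open>burden_at_most (1 / \<alpha>)\<close> for i and S.\<close>

lemma supportable_iff:
  assumes "0 < \<alpha>"
  shows "supportable F W a r \<mu> \<alpha> \<longleftrightarrow>
    (\<exists>z. (\<forall>j\<in>W. 0 \<le> z j) \<and> burden_at_most (1 / \<alpha>) z)"
proof
  assume "supportable F W a r \<mu> \<alpha>"
  then obtain x y where y: "\<forall>j\<in>W. 0 \<le> y j" and lf: "local_financing F a \<mu> x y"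
    and core: "in_core F W a r \<alpha> x y"
    by (auto simp: supportable_def)
  have "burden_at_most (1 / \<alpha>) (\<lambda>j. y j / \<alpha>)"
    unfolding burden_at_most_def
  proof (intro ballI allI impI)
    fix i S assume iS: "i \<in> F" "S \<subseteq> W" "card S \<le> r i"
    have "\<alpha> * coalition_value a i S \<le> x i + sum y S"
      using core iS y assms by (simp add: in_core_iff_single_firm)
    moreover have "x i + sum y (\<mu> i) = B i"
      using lf iS by (auto simp: local_financing_def)
    ultimately have "sum y (\<mu> i) + \<alpha> * coalition_value a i S - sum y S \<le> B i" by linarith
    then have "(sum y (\<mu> i) + \<alpha> * coalition_value a i S - sum y S) / \<alpha> \<le> B i / \<alpha>"
      using assms by (intro divide_right_mono) auto
    then show "(\<Sum>j\<in>\<mu> i. y j / \<alpha>) + (\<Sum>j\<in>S. a i j - y j / \<alpha>) \<le> 1 / \<alpha> * B i"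
      using assms by (simp add: sum_subtractf coalition_value_def[of a i S]
          add_divide_distrib diff_divide_distrib flip: sum_divide_distrib)
  qed
  then show "\<exists>z. (\<forall>j\<in>W. 0 \<le> z j) \<and> burden_at_most (1 / \<alpha>) z"
    using y assms by (intro exI[of _ "\<lambda>j. y j / \<alpha>"]) simp
next
  assume "\<exists>z. (\<forall>j\<in>W. 0 \<le> z j) \<and> burden_at_most (1 / \<alpha>) z"
  then obtain z where z: "\<forall>j\<in>W. 0 \<le> z j" and bound: "burden_at_most (1 / \<alpha>) z" by blast
  define y where "y j = \<alpha> * z j" for j
  define x where "x i = B i - sum y (\<mu> i)" for i
  have y: "\<forall>j\<in>W. 0 \<le> y j" using z assms by (simp add: y_def)
  have single: "\<alpha> * coalition_value a i S \<le> x i + sum y S"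
    if iS: "i \<in> F" "S \<subseteq> W" "card S \<le> r i" for i S
  proof -
    have "(\<Sum>j\<in>\<mu> i. z j) + (\<Sum>j\<in>S. a i j - z j) \<le> 1 / \<alpha> * B i"
      using bound iS by (auto simp: burden_at_most_def)
    then have "\<alpha> * ((\<Sum>j\<in>\<mu> i. z j) + (\<Sum>j\<in>S. a i j - z j)) \<le> B i"
      using assms by (simp add: field_simps)
    then show ?thesis
      by (simp add: x_def y_def sum_subtractf coalition_value_def[of a i S]
          algebra_simps flip: sum_distrib_left)
  qed
  have "in_core F W a r \<alpha> x y"
    using single y assms by (simp add: in_core_iff_single_firm)
  \<comment> \<open>Nonnegative profits are the single-firm inequalities for the empty set of
    workers.\<close>
  moreover have "\<forall>i\<in>F. 0 \<le> x i"
    using single[of _ "{}"] by (simp add: coalition_value_def[of _ _ "{}"])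
  moreover have "local_financing F a \<mu> x y"
    by (simp add: local_financing_def x_def)
  ultimately show "supportable F W a r \<mu> \<alpha>"
    using y by (auto simp: supportable_def)
qed

section \<open>Existence of a minimizer\<close>

text \<open>Truncation can only lower the sum over \<mu>(i). In the sum over \<open>S\<close>, a
  worker with z j > M contributes a i j - M \<le> 0 afterwards, so the old inequality for the other
  workers of \<open>S\<close>, whose z j is unchanged, suffices.\<close>

lemma burden_at_most_truncate:
  assumes M: "\<And>i j. i \<in> F \<Longrightarrow> j \<in> W \<Longrightarrow> a i j \<le> M" and bound: "burden_at_most t z"
  shows "burden_at_most t (\<lambda>j. min (z j) M)"
  unfolding burden_at_most_def
proof (intro ballI allI impI)
  fix i S assume iS: "i \<in> F" "S \<subseteq> W" "card S \<le> r i"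
  let ?S = "{j \<in> S. z j \<le> M}"
  have fin: "finite S" using iS finite_W finite_subset by blast
  then have "card ?S \<le> card S" by (intro card_mono) auto
  then have "?S \<subseteq> W" "card ?S \<le> r i" using iS by auto
  then have "(\<Sum>j\<in>\<mu> i. z j) + (\<Sum>j\<in>?S. a i j - z j) \<le> t * B i"
    using bound iS(1) unfolding burden_at_most_def by blast
  moreover have "(\<Sum>j\<in>\<mu> i. min (z j) M) \<le> (\<Sum>j\<in>\<mu> i. z j)"
    by (intro sum_mono) simp
  moreover have "(\<Sum>j\<in>S. a i j - min (z j) M) \<le> (\<Sum>j\<in>?S. a i j - z j)"
    unfolding sum.inter_filter[OF fin]
    using iS M by (intro sum_mono) (auto simp: min_def subset_iff)
  ultimately show "(\<Sum>j\<in>\<mu> i. min (z j) M) + (\<Sum>j\<in>S. a i j - min (z j) M) \<le> t * B i"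
    by linarith
qed

text \<open>The given vectors may be unbounded, for instance at unmatched workers. Truncating them
  at M makes them bounded without losing the inequalities, which then pass to the limit of a
  subsequence.\<close>

lemma burden_at_most_limit:
  assumes z: "\<And>n j. j \<in> W \<Longrightarrow> 0 \<le> z n j" and bound: "\<And>n. burden_at_most (t n) (z n)"
    and lim: "t \<longlonglongrightarrow> c"
  obtains l where "\<And>j. j \<in> W \<Longrightarrow> 0 \<le> l j" and "burden_at_most c l"
proof -
  \<comment> \<open>The total of all values bounds each of them because they are nonnegative. It is
    also nonnegative when there are no firms, so truncation at M keeps vectors nonnegative.\<close>
  define M where "M = (\<Sum>i\<in>F. \<Sum>j\<in>W. a i j)"
  have M: "a i j \<le> M" if "i \<in> F" "j \<in> W" for i j
  proof -
    have "a i j \<le> (\<Sum>j\<in>W. a i j)"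
      using that finite_W value_nonneg by (intro member_le_sum) auto
    also have "\<dots> \<le> M"
      unfolding M_def using that finite_F value_nonneg
      by (intro member_le_sum) (auto intro!: sum_nonneg)
    finally show ?thesis .
  qed
  have "0 \<le> M" unfolding M_def by (intro sum_nonneg value_nonneg)
  define Z where "Z n j = min (z n j) M" for n j
  have Z_bounds: "0 \<le> Z n j" "Z n j \<le> M" if "j \<in> W" for n j
    using z[OF that] \<open>0 \<le> M\<close> by (auto simp: Z_def)
  have "Bseq (\<lambda>n. Z n j)" if "j \<in> W" for j
    using Z_bounds[OF that] by (intro BseqI'[where K = M]) auto
  then obtain s l where s: "strict_mono s"
    and l: "\<And>j. j \<in> W \<Longrightarrow> (\<lambda>n. Z (s n) j) \<longlonglongrightarrow> l j"
    using finite_family_convergent_subseq[OF finite_W, of Z] by blast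
  have "burden_at_most c l"
    unfolding burden_at_most_def
  proof (intro ballI allI impI)
    fix i S assume iS: "i \<in> F" "S \<subseteq> W" "card S \<le> r i"
    show "(\<Sum>j\<in>\<mu> i. l j) + (\<Sum>j\<in>S. a i j - l j) \<le> c * B i"
    proof (rule LIMSEQ_le)
      show "(\<lambda>n. (\<Sum>j\<in>\<mu> i. Z (s n) j) + (\<Sum>j\<in>S. a i j - Z (s n) j))
          \<longlonglongrightarrow> (\<Sum>j\<in>\<mu> i. l j) + (\<Sum>j\<in>S. a i j - l j)"
        using iS matched_subset by (intro tendsto_intros l) blast+
      show "(\<lambda>n. t (s n) * B i) \<longlonglongrightarrow> c * B i"
        using LIMSEQ_subseq_LIMSEQ[OF lim s] by (intro tendsto_intros) (simp add: o_def)
      have "burden_at_most (t (s n)) (Z (s n))" for n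
        using burden_at_most_truncate[OF M bound] by (simp add: Z_def[abs_def])
      then show "\<exists>N. \<forall>n\<ge>N. (\<Sum>j\<in>\<mu> i. Z (s n) j) + (\<Sum>j\<in>S. a i j - Z (s n) j) \<le> t (s n) * B i"
        using iS by (auto simp: burden_at_most_def)
    qed
  qed
  moreover have "0 \<le> l j" if "j \<in> W" for j
    using l[OF that] Z_bounds[OF that] by (intro LIMSEQ_le_const) auto
  ultimately show ?thesis using that by blast
qed

lemma core_ratio_attained:
  "\<exists>z. (\<forall>j\<in>W. 0 \<le> z j) \<and> max_ratio F W a r \<mu> z = core_ratio F W a r \<mu>"
proof -
  have lower: "core_ratio F W a r \<mu> \<le> max_ratio F W a r \<mu> z" if "\<forall>j\<in>W. 0 \<le> z j" for z
    unfolding core_ratio_def using that by (intro INF_lower) simp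
  show ?thesis
  proof (cases "core_ratio F W a r \<mu>")
    case (real c)
    \<comment> \<open>The bounds lie strictly above the infimum c, so each is met by some admissible
      vector, and they decrease to c.\<close>
    define t where "t n = c + 1 / real (Suc n)" for n
    have "\<exists>z. (\<forall>j\<in>W. 0 \<le> z j) \<and> burden_at_most (t n) z" for n
    proof -
      have "core_ratio F W a r \<mu> < ennreal (t n)"
        using real by (simp add: t_def ennreal_less_iff)
      then obtain z where "\<forall>j\<in>W. 0 \<le> z j" "max_ratio F W a r \<mu> z < ennreal (t n)"
        unfolding core_ratio_def INF_less_iff by auto
      then show ?thesis
        using max_ratio_le_iff[of "t n" z] real by (auto simp: t_def)
    qed
    then obtain z where "\<And>n j. j \<in> W \<Longrightarrow> 0 \<le> z n j" "\<And>n. burden_at_most (t n) (z n)"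
      by metis
    moreover have "t \<longlonglongrightarrow> c"
      using tendsto_add[OF tendsto_const LIMSEQ_Suc[OF lim_1_over_n], of c] by (simp add: t_def[abs_def])
    ultimately obtain l where l: "\<And>j. j \<in> W \<Longrightarrow> 0 \<le> l j" "burden_at_most c l"
      using burden_at_most_limit by blast
    then have "max_ratio F W a r \<mu> l \<le> core_ratio F W a r \<mu>"
      using real max_ratio_le_iff by simp
    then show ?thesis using lower l(1) by (meson antisym)
  next
    \<comment> \<open>If the infimum is infinite, every admissible vector attains it.\<close>
    case top
    then show ?thesis using lower[of "\<lambda>_. 0"] by (auto simp: top_unique intro!: exI[of _ "\<lambda>_. 0"])
  qed
qed

section \<open>The optimal core factor\<close>

lemma supportable_iff_core_ratio_le:
  assumes "0 < \<alpha>"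
  shows "supportable F W a r \<mu> \<alpha> \<longleftrightarrow> core_ratio F W a r \<mu> \<le> ennreal (1 / \<alpha>)"
proof -
  have "supportable F W a r \<mu> \<alpha> \<longleftrightarrow>
      (\<exists>z. (\<forall>j\<in>W. 0 \<le> z j) \<and> max_ratio F W a r \<mu> z \<le> ennreal (1 / \<alpha>))"
    using assms by (simp add: supportable_iff max_ratio_le_iff)
  also have "\<dots> \<longleftrightarrow> core_ratio F W a r \<mu> \<le> ennreal (1 / \<alpha>)"
  proof
    assume "\<exists>z. (\<forall>j\<in>W. 0 \<le> z j) \<and> max_ratio F W a r \<mu> z \<le> ennreal (1 / \<alpha>)"
    then show "core_ratio F W a r \<mu> \<le> ennreal (1 / \<alpha>)"
      unfolding core_ratio_def by (auto intro: INF_lower2)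
  next
    \<comment> \<open>Attainment is essential here: when equality holds, the infimum alone would not
      yield a vector meeting the bound.\<close>
    assume "core_ratio F W a r \<mu> \<le> ennreal (1 / \<alpha>)"
    then show "\<exists>z. (\<forall>j\<in>W. 0 \<le> z j) \<and> max_ratio F W a r \<mu> z \<le> ennreal (1 / \<alpha>)"
      using core_ratio_attained by metis
  qed
  finally show ?thesis .
qed

lemma core_factor_upper:
  "0 \<le> \<alpha> \<Longrightarrow> supportable F W a r \<mu> \<alpha> \<Longrightarrow> ennreal \<alpha> \<le> core_factor F W a r \<mu>"
  unfolding core_factor_def by (intro SUP_upper) simp

lemma core_factor_attained_and_eq:
  "(core_factor F W a r \<mu> \<noteq> \<infinity> \<longrightarrow>
      supportable F W a r \<mu> (enn2real (core_factor F W a r \<mu>))) \<and>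
   core_factor F W a r \<mu> = 1 / core_ratio F W a r \<mu>"
proof (cases "core_ratio F W a r \<mu>")
  case top
  \<comment> \<open>No finite bound 1 / \<alpha> reaches an infinite ratio, which excludes every
    positive factor.\<close>
  have "\<alpha> = 0" if "0 \<le> \<alpha>" "supportable F W a r \<mu> \<alpha>" for \<alpha>
    using that supportable_iff_core_ratio_le[of \<alpha>] top by (auto simp: top_unique order_le_less)
  then have "core_factor F W a r \<mu> \<le> 0"
    unfolding core_factor_def by (intro SUP_least) auto
  then show ?thesis using supportable_zero top by simp
next
  case (real c)
  show ?thesis
  proof (cases "c = 0")
    case True
    \<comment> \<open>A zero ratio lies below every bound 1 / \<alpha>, so arbitrarily large factors
      are supportable and their supremum is infinite.\<close>
    have "supportable F W a r \<mu> (real (Suc n))" for n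
      using supportable_iff_core_ratio_le[of "real (Suc n)"] real True by simp
    then have "ennreal (real (Suc n)) \<le> core_factor F W a r \<mu>" for n
      by (intro core_factor_upper) auto
    then have "core_factor F W a r \<mu> = \<infinity>"
      by (metis ennreal_of_nat_eq_real_of_nat ennreal_Ex_less_of_nat less_le_not_le
          infinity_ennreal_def lessI less_imp_of_nat_less order_less_trans top.not_eq_extremum)
    then show ?thesis using real True by simp
  next
    case False
    then have c: "0 < c" using real by simp
    \<comment> \<open>For the factor 1 / c the bound on the ratio is c itself, so the criterion
      holds with equality and the supremum is attained.\<close>
    have supp: "supportable F W a r \<mu> (1 / c)"
      using supportable_iff_core_ratio_le[of "1 / c"] real c by simp
    have "\<alpha> \<le> 1 / c" if "0 \<le> \<alpha>" "supportable F W a r \<mu> \<alpha>" for \<alpha>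
    proof (cases "\<alpha> = 0")
      case False
      then have "ennreal c \<le> ennreal (1 / \<alpha>)"
        using that supportable_iff_core_ratio_le[of \<alpha>] real by auto
      then show ?thesis using False that c by (simp add: ennreal_le_iff field_simps)
    qed (use c in simp)
    then have "core_factor F W a r \<mu> \<le> ennreal (1 / c)"
      unfolding core_factor_def by (intro SUP_least ennreal_leI) auto
    moreover have "ennreal (1 / c) \<le> core_factor F W a r \<mu>"
      using supp c by (intro core_factor_upper) auto
    ultimately have eq: "core_factor F W a r \<mu> = ennreal (1 / c)" by (rule antisym)
    have "1 / core_ratio F W a r \<mu> = ennreal (1 / c)"
      using divide_ennreal[of 1 c] real c by simp
    then show ?thesis using supp c eq by simp
  qed
qed

end

(* The first conjunct says that the infimum core_ratio is a minimum, the second that the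
   supremum core_factor, when finite, is a maximum.  Division in ennreal satisfies
   1 / 0 = \<infinity> and 1 / \<infinity> = 0. *)
theorem theorem14:
  fixes F :: "'f set" and W :: "'w set"
    and a :: "'f \<Rightarrow> 'w \<Rightarrow> real" and r :: "'f \<Rightarrow> nat" and \<mu> :: "'f \<Rightarrow> 'w set"
  assumes "finite F" and "finite W"
    and "\<And>i j. i \<in> F \<Longrightarrow> j \<in> W \<Longrightarrow> a i j \<ge> 0"
    and "capacity_matching F W r \<mu>"
  shows "(\<exists>z. (\<forall>j\<in>W. z j \<ge> 0) \<and> max_ratio F W a r \<mu> z = core_ratio F W a r \<mu>) \<and>
         (core_factor F W a r \<mu> \<noteq> \<infinity> \<longrightarrow>
            supportable F W a r \<mu> (enn2real (core_factor F W a r \<mu>))) \<and>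
         core_factor F W a r \<mu> = 1 / core_ratio F W a r \<mu>"
proof -
  interpret capacity_market F W a r \<mu>
    using assms by unfold_locales
  show ?thesis using core_ratio_attained core_factor_attained_and_eq by blast
qed

end
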